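(* Let $n\ge 1$, let $v\in Z_4^n$ be a column vector, and let $G=(v,I_n)$ be the $n\times(n+1)$ generator matrix over $Z_4$. For $i=0,1,2,3$ let $f_i$ be the number of entries of $v$ equal to $i$. Define $k_1=f_1+2f_2+f_3+1$, $k_2=2f_1+2f_3+2$ and $\rho=2^{-\lfloor (f_1+f_3)/2\rfloor}$. Then the two-level $2^{2n}\times(2n+2)$ design $D$ generated by $G$ has 1 complete word of length $k_2$ and $2/\rho^2$ partial words of length $k_1$ with aliasing index $\rho$. (That is, $D$ has exactly $1+2/\rho^2$ words: one word of length $k_2$ with aliasing index $1$, and $2/\rho^2$ further words, each of length $k_1$ and aliasing index $\rho$.)
   Context: $Z_4=\{0,1,2,3\}$ is the ring of integers modulo 4. Design generated by $G=(v,I_n)$: let $C$ be the $2^{2n}\times(n+1)$ matrix whose rows are all linear combinations $uG$, $u\in Z_4^n$. Replace each entry of $C$ by a pair of $\pm1$ symbols via the Gray map $0\mapsto(1,1)$, $1\mapsto(1,-1)$, $2\mapsto(-1,-1)$, $3\mapsto(-1,1)$, so that column $j$ of $C$ becomes columns $2j-1,2j$. The result $D$ is a $2^{2n}\times(2n+2)$ matrix with entries $\pm1$ (a two-level design; rows are runs, columns are factors; row order is irrelevant). For a two-level design $D$ with $N$ runs and $m$ factors and a nonempty set $s$ of $k$ columns of $D$, let $j_k(s;D)=\sum_{i=1}^N\prod_{c\in s}c_i$, where $c_i$ is the $i$th entry of column $c$, and let the aliasing index be $\rho_k(s;D)=|j_k(s;D)|/N\in[0,1]$. If $\rho_k(s;D)>0$,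 the set $s$ is a word of length $k$ with aliasing index $\rho_k(s;D)$; it is a complete word if the aliasing index is 1, and otherwise a partial word (a "partial word with aliasing index 1" is allowed as a name for a complete word). If $\rho_k(s;D)=0$, $s$ is not a word. An enumeration of the words of a design is understood to list all of its words. *)

theory Defs
  imports "HOL-Library.Numeral_Type" "Jordan_Normal_Form.Matrix"
begin

text \<open>The ring of integers modulo 4 is the library type \<open>4\<close>, with its modular arithmetic.
  All row and column indices start at 0, as is usual for \<open>mat\<close>.\<close>

definition generator_matrix :: "nat \<Rightarrow> 4 vec \<Rightarrow> 4 mat" where
  "generator_matrix n v = mat_of_cols n (v # cols (1\<^sub>m n))"

text \<open>The order of the runs is irrelevant, so it is left open: \<open>us\<close> may be any list that contains
  every vector of length \<open>n\<close> exactly once.\<close>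

definition lists_all_vecs :: "nat \<Rightarrow> 4 vec list \<Rightarrow> bool" where
  "lists_all_vecs n us \<longleftrightarrow> distinct us \<and> set us = carrier_vec n"

definition linear_combinations :: "4 vec list \<Rightarrow> 4 mat \<Rightarrow> 4 mat" where
  "linear_combinations us G = mat_of_rows (dim_row G) us * G"

definition gray :: "4 \<Rightarrow> int \<times> int" where
  "gray x = (if x = 0 then (1, 1) else if x = 1 then (1, -1)
             else if x = 2 then (-1, -1) else (-1, 1))"

definition gray_image :: "4 mat \<Rightarrow> int mat" where
  "gray_image C = mat (dim_row C) (2 * dim_col C)
     (\<lambda>(i, c). (if even c then fst else snd) (gray (C $$ (i, c div 2))))"

definition design :: "4 vec list \<Rightarrow> 4 mat \<Rightarrow> int mat" where
  "design us G = gray_image (linear_combinations us G)"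

text \<open>A set of columns is a set of column indices, since two columns of a design may have the same
  entries.\<close>

definition j_char :: "int mat \<Rightarrow> nat set \<Rightarrow> int" where
  "j_char D s = (\<Sum>i<dim_row D. \<Prod>c\<in>s. D $$ (i, c))"

definition aliasing_index :: "int mat \<Rightarrow> nat set \<Rightarrow> real" where
  "aliasing_index D s = \<bar>real_of_int (j_char D s)\<bar> / real (dim_row D)"

definition words :: "int mat \<Rightarrow> nat set set" where
  "words D = {s. s \<noteq> {} \<and> s \<subseteq> {..<dim_col D} \<and> aliasing_index D s > 0}"

definition entry_count :: "4 vec \<Rightarrow> 4 \<Rightarrow> nat" where
  "entry_count v a = card {r. r < dim_vec v \<and> v $ r = a}"

lemma bij_betw_list_of_vec:
  "bij_betw list_of_vec (carrier_vec n :: 4 vec set) {xs. length xs = n}"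
proof (rule bij_betw_byWitness[where f' = vec_of_list])
  show "list_of_vec ` (carrier_vec n :: 4 vec set) \<subseteq> {xs. length xs = n}"
    using carrier_vecD by auto
  show "vec_of_list ` {xs. length xs = n} \<subseteq> (carrier_vec n :: 4 vec set)"
    by (auto intro!: carrier_vecI)
qed (intro ballI, rule vec_list, intro ballI, rule list_vec)

lemma finite_carrier_vec4: "finite (carrier_vec n :: 4 vec set)"
  using finite_lists_length_eq[of "UNIV :: 4 set" n] bij_betw_finite[OF bij_betw_list_of_vec]
  by auto

lemma card_carrier_vec4: "card (carrier_vec n :: 4 vec set) = 2 ^ (2 * n)"
  using card_lists_length_eq[of "UNIV :: 4 set" n] bij_betw_same_card[OF bij_betw_list_of_vec[of n]]
  by (simp add: power_mult)

lemma lists_all_vecs_exists: "\<exists>us. lists_all_vecs n us"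
  using finite_distinct_list[OF finite_carrier_vec4] unfolding lists_all_vecs_def by blast

lemma design_carrier:
  assumes "lists_all_vecs n us"
  shows "design us (generator_matrix n v) \<in> carrier_mat (2 ^ (2 * n)) (2 * n + 2)"
proof -
  have "length us = 2 ^ (2 * n)"
    using assms distinct_card[of us] card_carrier_vec4[of n] by (simp add: lists_all_vecs_def)
  then show ?thesis
    unfolding design_def gray_image_def linear_combinations_def generator_matrix_def
    by (intro carrier_matI) simp_all
qed

end

theory Submission
  imports Defs Complex_Main
begin

text \<open>Let \<open>T\<^sub>j\<close> be the part of a set \<open>s\<close> of columns that lies in the Gray image of the \<open>j\<close>-th column
  of the code. The product of the entries of a run over \<open>T\<^sub>j\<close> is a function on \<open>Z\<^sub>4\<close>; expanding it in the
  additive characters of \<open>Z\<^sub>4\<close> and summing over all runs leaves only the characters that vanish on the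
  code, that is, the multiples of the dual vector \<open>z = (1, -v)\<close>. Hence the signed aliasing index of \<open>s\<close>
  is \<open>\<Sum>k\<in>Z\<^sub>4. \<Prod>j. c(T\<^sub>j, k z\<^sub>j)\<close> with the Fourier coefficients \<open>c\<close>. The term \<open>k = 0\<close> is supported on the
  empty set and \<open>k = 2\<close> on the complete word. The terms \<open>k = 1, 3\<close> are complex conjugates, nonzero iff
  \<open>T\<^sub>j\<close> is empty, a singleton or full for \<open>z\<^sub>j = 0\<close>, \<open>z\<^sub>j\<close> odd or \<open>z\<^sub>j = 2\<close> respectively. Such an \<open>s\<close> is
  determined by the set \<open>Q\<close> of odd positions that contribute \<open>(1 + \<i>)/2\<close>, the other ones contributing
  \<open>(1 - \<i>)/2\<close>, and the real part of the product of these factors gives the aliasing index.\<close>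

section \<open>Characters of Z_4 and the Fourier expansion of the Gray map\<close>

lemma UNIV_4: "(UNIV :: 4 set) = {0, 1, 2, 3}"
  by (rule card_subset_eq[symmetric]) simp_all

lemma exhaust_4: "x = 0 \<or> x = 1 \<or> x = 2 \<or> x = 3" for x :: 4
  using UNIV_4 by blast

lemma numerals_4:
  "(4 :: 4) = 0" "(6 :: 4) = 2" "(9 :: 4) = 1"
  "- (1 :: 4) = 3" "- (2 :: 4) = 2" "- (3 :: 4) = 1"
  by simp_all

text \<open>The character \<open>x \<mapsto> \<i> ^ x\<close>; the functions
  \<open>chi (k * x)\<close> are all the additive characters of Z_4.\<close>

definition chi :: "4 \<Rightarrow> complex" where
  "chi x = (if x = 0 then 1 else if x = 1 then \<i> else if x = 2 then -1 else -\<i>)"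

lemma chi_add: "chi (x + y) = chi x * chi y"
  using exhaust_4[of x] exhaust_4[of y] by (elim disjE) (simp_all add: chi_def)

lemma chi_sum: "finite A \<Longrightarrow> chi (sum f A) = (\<Prod>x\<in>A. chi (f x))"
  by (induction A rule: finite_induct) (simp_all add: chi_add, simp add: chi_def)

text \<open>The Booleans tell which of the two Gray columns of a code column are selected.\<close>

definition gray_prod :: "bool \<Rightarrow> bool \<Rightarrow> 4 \<Rightarrow> int" where
  "gray_prod a b x = (if a then fst (gray x) else 1) * (if b then snd (gray x) else 1)"

text \<open>The Fourier coefficients of \<open>gray_prod a b\<close>: an empty pair is the trivial
  character, a full pair is \<open>chi (2 * x)\<close>, and a single Gray column combines
  \<open>chi x\<close> with its conjugate.\<close>

definition gray_coeff :: "bool \<Rightarrow> bool \<Rightarrow> 4 \<Rightarrow> complex" where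
  "gray_coeff a b k =
    (if a = b then of_bool (k = (if a then 2 else 0))
     else if k = 1 then (if a then (1 - \<i>) / 2 else (1 + \<i>) / 2)
     else if k = 3 then (if a then (1 + \<i>) / 2 else (1 - \<i>) / 2)
     else 0)"

lemma sum_UNIV_4: "(\<Sum>x\<in>UNIV. f x) = f 0 + f 1 + f 2 + f (3 :: 4)"
  unfolding UNIV_4 by (simp add: add.assoc)

lemma chi_simps: "chi 0 = 1" "chi 1 = \<i>" "chi 2 = -1" "chi 3 = -\<i>"
  by (simp_all add: chi_def)

lemma gray_simps: "gray 0 = (1, 1)" "gray 1 = (1, -1)" "gray 2 = (-1, -1)" "gray 3 = (-1, 1)"
  by (simp_all add: gray_def)

lemma gray_coeff_simps:
  "gray_coeff True True k = of_bool (k = 2)" "gray_coeff False False k = of_bool (k = 0)"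
  "gray_coeff True False 0 = 0" "gray_coeff True False 2 = 0"
  "gray_coeff False True 0 = 0" "gray_coeff False True 2 = 0"
  "gray_coeff True False 1 = (1 - \<i>) / 2" "gray_coeff True False 3 = (1 + \<i>) / 2"
  "gray_coeff False True 1 = (1 + \<i>) / 2" "gray_coeff False True 3 = (1 - \<i>) / 2"
  by (simp_all add: gray_coeff_def)

lemma gray_prod_expand:
  "complex_of_int (gray_prod a b x) = (\<Sum>k\<in>UNIV. gray_coeff a b k * chi (k * x))"
proof -
  have "\<forall>x\<in>UNIV. complex_of_int (gray_prod a b x) =
      (\<Sum>k\<in>UNIV. gray_coeff a b k * chi (k * x))"
    unfolding sum_UNIV_4 unfolding UNIV_4
    by (cases a; cases b)
      (simp_all add: numerals_4 gray_prod_def gray_simps chi_simps gray_coeff_simps,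
        simp_all add: complex_eq_iff)
  then show ?thesis by blast
qed

text \<open>Orthogonality of characters leaves a single coefficient, times the group order 4. The
  sign in \<open>- k\<close> is the source of the entries \<open>-v\<close> in the dual
  vector.\<close>

lemma gray_prod_transform:
  "(\<Sum>x\<in>UNIV. chi (k * x) * complex_of_int (gray_prod a b x)) = 4 * gray_coeff a b (- k)"
proof -
  have "\<forall>k\<in>UNIV. (\<Sum>x\<in>UNIV. chi (k * x) * complex_of_int (gray_prod a b x)) =
      4 * gray_coeff a b (- k)"
    unfolding sum_UNIV_4 unfolding UNIV_4
    by (cases a; cases b)
      (simp_all add: numerals_4 gray_prod_def gray_simps chi_simps gray_coeff_simps)
  then show ?thesis by blast
qed

definition odd4 :: "4 \<Rightarrow> bool" where "odd4 x \<longleftrightarrow> x = 1 \<or> x = 3"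

text \<open>Doubling sends odd elements to 2 and even ones to 0; at 2 only a full pair, at 0 only an
  empty pair has a nonzero coefficient, namely 1.\<close>

lemma gray_coeff_double: "gray_coeff a b (2 * x) = of_bool (a = odd4 x \<and> b = odd4 x)"
  using exhaust_4[of x]
  by (cases a; cases b; elim disjE) (simp_all add: gray_coeff_def odd4_def)

text \<open>Conjugate symmetry, since \<open>gray_prod a b\<close> is real valued.\<close>

lemma gray_coeff_uminus: "gray_coeff a b (- x) = cnj (gray_coeff a b x)"
  using exhaust_4[of x]
  by (cases a; cases b; elim disjE) (simp_all add: gray_coeff_def)

section \<open>Column sets split into Gray pairs, and sums over all vectors\<close>

lemma prod_lessThan_double:
  "(\<Prod>c<2 * m. f c) = (\<Prod>j<m. f (2 * j) * f (Suc (2 * j)))"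
  for f :: "nat \<Rightarrow> 'a :: comm_monoid_mult"
  by (induction m) (simp_all add: mult.assoc)

lemma sum_lessThan_double:
  "(\<Sum>c<2 * m. f c) = (\<Sum>j<m. f (2 * j) + f (Suc (2 * j)))"
  for f :: "nat \<Rightarrow> 'a :: comm_monoid_add"
  by (induction m) (simp_all add: add.assoc)

text \<open>Padding \<open>f\<close> with 1 outside \<open>s\<close> extends the product to all
  columns, which split into the pairs \<open>2 * j\<close>, \<open>Suc (2 * j)\<close>.\<close>

lemma prod_column_pairs:
  fixes f :: "nat \<Rightarrow> 'a :: comm_monoid_mult"
  assumes "s \<subseteq> {..<2 * m}"
  shows "(\<Prod>c\<in>s. f c) =
    (\<Prod>j<m. (if 2 * j \<in> s then f (2 * j) else 1) * (if Suc (2 * j) \<in> s then f (Suc (2 * j)) else 1))"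
proof -
  have "(\<Prod>c\<in>s. f c) = (\<Prod>c<2 * m. if c \<in> s then f c else 1)"
    using assms by (simp add: prod.inter_restrict[symmetric] Int_absorb1)
  then show ?thesis by (simp only: prod_lessThan_double)
qed

lemma card_column_pairs:
  fixes s :: "nat set"
  assumes "s \<subseteq> {..<2 * m}"
  shows "card s = (\<Sum>j<m. of_bool (2 * j \<in> s) + of_bool (Suc (2 * j) \<in> s))"
proof -
  have "card s = (\<Sum>c<2 * m. of_bool (c \<in> s))"
    using assms by (simp add: Int_absorb1 of_bool_def sum.inter_restrict[symmetric])
  then show ?thesis by (simp only: sum_lessThan_double)
qed

text \<open>Vectors correspond to functions on \<open>{..<n}\<close>, so this is distributivity; it
  lets a sum over all runs factor by coordinates.\<close>

lemma sum_carrier_vec: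
  fixes F :: "nat \<Rightarrow> 'a :: finite \<Rightarrow> 'b :: comm_semiring_1"
  shows "(\<Sum>u\<in>carrier_vec n. \<Prod>r<n. F r (u $ r)) = (\<Prod>r<n. \<Sum>x\<in>UNIV. F r x)"
proof -
  have "(\<Sum>u\<in>carrier_vec n. \<Prod>r<n. F r (u $ r)) =
      (\<Sum>g\<in>PiE {..<n} (\<lambda>_. UNIV). \<Prod>r<n. F r (g r))"
    by (rule sum.reindex_bij_witness[of _ "\<lambda>g. vec n g" "\<lambda>u. restrict (($) u) {..<n}"])
      (auto intro!: eq_vecI ext simp: PiE_def extensional_def)
  then show ?thesis by (simp add: prod_sum_PiE)
qed

section \<open>The code, its dual vector and the character sum of a column set\<close>

definition code_entry :: "4 vec \<Rightarrow> 4 vec \<Rightarrow> nat \<Rightarrow> 4" where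
  "code_entry v u j = (if j = 0 then u \<bullet> v else u $ (j - 1))"

text \<open>The vector (1, -v), orthogonal to every row of (v, I_n); its multiples form the dual
  code.\<close>

definition check_vec :: "4 vec \<Rightarrow> nat \<Rightarrow> 4" where
  "check_vec v j = (if j = 0 then 1 else - v $ (j - 1))"

definition spectrum_term :: "4 vec \<Rightarrow> nat set \<Rightarrow> 4 \<Rightarrow> complex" where
  "spectrum_term v s k =
    (\<Prod>j<Suc (dim_vec v). gray_coeff (2 * j \<in> s) (Suc (2 * j) \<in> s) (k * check_vec v j))"

lemma linear_combinations_entry:
  assumes "v \<in> carrier_vec n" "set us \<subseteq> carrier_vec n" "i < length us" "j < Suc n"
  shows "linear_combinations us (generator_matrix n v) $$ (i, j) = code_entry v (us ! i) j"
proof -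
  have u: "us ! i \<in> carrier_vec n" using assms by auto
  have "linear_combinations us (generator_matrix n v) $$ (i, j) =
      us ! i \<bullet> (v # cols (1\<^sub>m n)) ! j"
    using assms u
    by (simp add: linear_combinations_def generator_matrix_def del: nth_Cons_Suc)
      (subst col_mat_of_cols; auto simp: nth_Cons' less_Suc_eq_0_disj)
  also have "\<dots> = code_entry v (us ! i) j"
    using assms u by (auto simp: code_entry_def nth_Cons' less_Suc_eq_0_disj)
  finally show ?thesis .
qed

text \<open>Poisson summation: a sum over the code becomes a sum over the four multiples of the dual
  vector.\<close>

lemma j_char_design:
  assumes v: "v \<in> carrier_vec n" and us: "lists_all_vecs n us" and s: "s \<subseteq> {..<2 * Suc n}"
  shows "complex_of_int (j_char (design us (generator_matrix n v)) s) =
    4 ^ n * (\<Sum>k\<in>UNIV. spectrum_term v s k)"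
proof -
  let ?D = "design us (generator_matrix n v)"
  let ?a = "\<lambda>j. 2 * j \<in> s" and ?b = "\<lambda>j. Suc (2 * j) \<in> s"
  have dim: "dim_row ?D = length us"
    by (simp add: design_def gray_image_def linear_combinations_def)
  have us': "set us = carrier_vec n" "distinct us" using us by (auto simp: lists_all_vecs_def)
  have D: "?D $$ (i, c) = (if even c then fst else snd) (gray (code_entry v (us ! i) (c div 2)))"
    if "i < length us" "c < 2 * Suc n" for i c
  proof -
    have "dim_row (linear_combinations us (generator_matrix n v)) = length us"
      "dim_col (linear_combinations us (generator_matrix n v)) = Suc n"
      by (simp_all add: linear_combinations_def generator_matrix_def)
    moreover have "c div 2 < Suc n" using that by (intro less_mult_imp_div_less) simp
    ultimately show ?thesis
      using that linear_combinations_entry[OF v, of us i "c div 2"] us'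
      by (simp add: design_def gray_image_def)
  qed
  have row: "(\<Prod>c\<in>s. ?D $$ (i, c)) =
      (\<Prod>j<Suc n. gray_prod (?a j) (?b j) (code_entry v (us ! i) j))"
    if "i < length us" for i
    unfolding prod_column_pairs[OF s] using that
    by (intro prod.cong refl) (simp add: gray_prod_def D)
  have "j_char ?D s =
      (\<Sum>i<length us. \<Prod>j<Suc n. gray_prod (?a j) (?b j) (code_entry v (us ! i) j))"
    unfolding j_char_def dim by (intro sum.cong refl row) simp
  \<comment> \<open>As \<open>us\<close> is distinct, the order of the runs drops out.\<close>
  also have "\<dots> = (\<Sum>u\<in>carrier_vec n. \<Prod>j<Suc n. gray_prod (?a j) (?b j) (code_entry v u j))"
    using us' by (simp add: sum_list_sum_nth lessThan_atLeast0
        flip: us'(1) sum_list_distinct_conv_sum_set)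
  finally have "complex_of_int (j_char ?D s) = (\<Sum>u\<in>carrier_vec n.
      complex_of_int (gray_prod (?a 0) (?b 0) (u \<bullet> v)) *
        (\<Prod>r<n. complex_of_int (gray_prod (?a (Suc r)) (?b (Suc r)) (u $ r))))"
    by (simp add: prod.lessThan_Suc_shift code_entry_def del: prod.lessThan_Suc)
  \<comment> \<open>Only column 0 couples the coordinates of \<open>u\<close>. Expanding its factor
    in characters turns the inner product \<open>u \<bullet> v\<close> into a product over
    coordinates.\<close>
  also have "\<dots> = (\<Sum>u\<in>carrier_vec n. \<Sum>k\<in>UNIV. gray_coeff (?a 0) (?b 0) k *
      (\<Prod>r<n. chi ((k * v $ r) * u $ r) *
        complex_of_int (gray_prod (?a (Suc r)) (?b (Suc r)) (u $ r))))"
  proof (intro sum.cong refl)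
    fix u :: "4 vec" assume "u \<in> carrier_vec n"
    have chi: "chi (k * (u \<bullet> v)) = (\<Prod>r<n. chi ((k * v $ r) * u $ r))" for k
      using v unfolding scalar_prod_def
      by (simp add: sum_distrib_left chi_sum lessThan_atLeast0 mult_ac)
    show "complex_of_int (gray_prod (?a 0) (?b 0) (u \<bullet> v)) *
        (\<Prod>r<n. complex_of_int (gray_prod (?a (Suc r)) (?b (Suc r)) (u $ r))) =
      (\<Sum>k\<in>UNIV. gray_coeff (?a 0) (?b 0) k * (\<Prod>r<n. chi ((k * v $ r) * u $ r) *
        complex_of_int (gray_prod (?a (Suc r)) (?b (Suc r)) (u $ r))))"
      unfolding gray_prod_expand[of _ _ "u \<bullet> v"] chi
      by (simp add: sum_distrib_right prod.distrib mult.assoc)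
  qed
  also have "\<dots> = (\<Sum>k\<in>UNIV. gray_coeff (?a 0) (?b 0) k * (\<Sum>u\<in>carrier_vec n.
      \<Prod>r<n. chi ((k * v $ r) * u $ r) *
        complex_of_int (gray_prod (?a (Suc r)) (?b (Suc r)) (u $ r))))"
    by (subst sum.swap) (simp only: sum_distrib_left)
  also have "\<dots> = (\<Sum>k\<in>UNIV. gray_coeff (?a 0) (?b 0) k *
      (\<Prod>r<n. 4 * gray_coeff (?a (Suc r)) (?b (Suc r)) (- (k * v $ r))))"
    by (subst sum_carrier_vec) (simp only: gray_prod_transform)
  \<comment> \<open>The leading coefficient is the factor at position 0, where the dual vector is
    1.\<close>
  also have "\<dots> = 4 ^ n * (\<Sum>k\<in>UNIV. spectrum_term v s k)"
    using v by (simp add: spectrum_term_def check_vec_def prod.lessThan_Suc_shift prod.distrib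
        sum_distrib_left mult_ac del: prod.lessThan_Suc)
  finally show ?thesis .
qed

section \<open>The candidate words, their lengths and their parametrization\<close>

lemma column_set_eqI:
  fixes s t :: "nat set"
  assumes "s \<subseteq> {..<2 * m}" "t \<subseteq> {..<2 * m}"
    and "\<And>j. j < m \<Longrightarrow> (2 * j \<in> s \<longleftrightarrow> 2 * j \<in> t) \<and> (Suc (2 * j) \<in> s \<longleftrightarrow> Suc (2 * j) \<in> t)"
  shows "s = t"
proof (rule Set.set_eqI)
  fix c
  show "c \<in> s \<longleftrightarrow> c \<in> t"
  proof (cases "c < 2 * m")
    case True
    then have "c div 2 < m" by (intro less_mult_imp_div_less) simp
    then show ?thesis
      using assms(3)[of "c div 2"] by (cases "even c") (auto elim!: evenE oddE)
  qed (use assms(1,2) in auto)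
qed

definition odd_positions :: "4 vec \<Rightarrow> nat set" where
  "odd_positions v = {j. j < Suc (dim_vec v) \<and> odd4 (check_vec v j)}"

text \<open>The Gray pairs at which twice the dual vector equals 2, hence the only set on which the
  term \<open>k = 2\<close> is nonzero.\<close>

definition full_word :: "4 vec \<Rightarrow> nat set" where
  "full_word v = {c. c < 2 * Suc (dim_vec v) \<and> odd4 (check_vec v (c div 2))}"

text \<open>The choice between the two Gray columns at an odd position is made such that the positions in \<open>Q\<close>
  are exactly those with Fourier coefficient \<open>(1 + \<i>)/2\<close> at \<open>k = 1\<close>.\<close>

definition partial_word :: "4 vec \<Rightarrow> nat set \<Rightarrow> nat set" where
  "partial_word v Q = {c. c < 2 * Suc (dim_vec v) \<and>
     (check_vec v (c div 2) = 2 \<or>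
      odd4 (check_vec v (c div 2)) \<and> (odd c \<longleftrightarrow> (c div 2 \<in> Q \<longleftrightarrow> check_vec v (c div 2) = 1)))}"

lemma full_word_subset: "full_word v \<subseteq> {..<2 * Suc (dim_vec v)}"
  by (auto simp: full_word_def)

lemma partial_word_subset: "partial_word v Q \<subseteq> {..<2 * Suc (dim_vec v)}"
  by (auto simp: partial_word_def)

lemma full_word_iff:
  assumes "j < Suc (dim_vec v)"
  shows "2 * j \<in> full_word v \<longleftrightarrow> odd4 (check_vec v j)"
    and "Suc (2 * j) \<in> full_word v \<longleftrightarrow> odd4 (check_vec v j)"
  using assms by (auto simp: full_word_def)

lemma partial_word_iff:
  assumes "j < Suc (dim_vec v)"
  shows "2 * j \<in> partial_word v Q \<longleftrightarrow> check_vec v j = 2 \<or>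
      odd4 (check_vec v j) \<and> (j \<in> Q \<longleftrightarrow> check_vec v j \<noteq> 1)"
    and "Suc (2 * j) \<in> partial_word v Q \<longleftrightarrow> check_vec v j = 2 \<or>
      odd4 (check_vec v j) \<and> (j \<in> Q \<longleftrightarrow> check_vec v j = 1)"
  using assms by (auto simp: partial_word_def)

lemma finite_odd_positions: "finite (odd_positions v)"
  by (simp add: odd_positions_def)

lemma odd4_simps: "\<not> odd4 0" "odd4 1" "\<not> odd4 2" "odd4 3"
  by (simp_all add: odd4_def)

lemma sum_of_bool_lessThan: "(\<Sum>j<m. of_bool (P j)) = card {j. j < m \<and> P j}" for m :: nat
  by (simp add: lessThan_def[symmetric] Collect_conj_eq)

lemma card_full_word: "card (full_word v) = 2 * card (odd_positions v)"
proof -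
  have "card (full_word v) = (\<Sum>j<Suc (dim_vec v). 2 * of_bool (odd4 (check_vec v j)))"
    unfolding card_column_pairs[OF full_word_subset]
    by (intro sum.cong refl) (simp add: full_word_iff)
  then show ?thesis
    by (simp only: odd_positions_def sum_of_bool_lessThan flip: sum_distrib_left)
qed

text \<open>Whatever \<open>Q\<close> is, an odd position contributes exactly one of its two
  columns; a position with check entry 2 contributes both.\<close>

lemma card_partial_word:
  "card (partial_word v Q) =
    2 * card {j. j < Suc (dim_vec v) \<and> check_vec v j = 2} + card (odd_positions v)"
proof -
  have "card (partial_word v Q) = (\<Sum>j<Suc (dim_vec v).
      2 * of_bool (check_vec v j = 2) + of_bool (odd4 (check_vec v j)))"
    unfolding card_column_pairs[OF partial_word_subset]
    by (intro sum.cong refl) (auto simp: partial_word_iff odd4_simps)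
  then show ?thesis
    by (simp only: odd_positions_def sum.distrib sum_of_bool_lessThan flip: sum_distrib_left)
qed

text \<open>At an odd position, membership of the first Gray column decides whether the position
  lies in \<open>Q\<close>.\<close>

lemma partial_word_inj: "inj_on (partial_word v) (Pow (odd_positions v))"
proof (rule inj_onI)
  fix Q R
  assume *: "Q \<in> Pow (odd_positions v)" "R \<in> Pow (odd_positions v)"
    "partial_word v Q = partial_word v R"
  have "j \<in> Q \<longleftrightarrow> j \<in> R" if "j \<in> odd_positions v" for j
    using that partial_word_iff(1)[of j v Q] partial_word_iff(1)[of j v R] *(3)
    by (auto simp: odd_positions_def odd4_simps)
  then show "Q = R" using *(1,2) by blast
qed

section \<open>The four spectral terms and their supports\<close>

lemma spectrum_term_0:
  assumes "s \<noteq> {}" "s \<subseteq> {..<2 * Suc (dim_vec v)}"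
  shows "spectrum_term v s 0 = 0"
proof (rule ccontr)
  assume "spectrum_term v s 0 \<noteq> 0"
  then have "\<forall>j<Suc (dim_vec v). gray_coeff (2 * j \<in> s) (Suc (2 * j) \<in> s) 0 \<noteq> 0"
    by (auto simp: spectrum_term_def simp del: prod.lessThan_Suc)
  then have "\<forall>j<Suc (dim_vec v). 2 * j \<notin> s \<and> Suc (2 * j) \<notin> s"
    by (auto simp: gray_coeff_def split: if_splits)
  then have "s = {}" by (intro column_set_eqI[OF assms(2)]) auto
  with assms show False by simp
qed

text \<open>By \<open>gray_coeff_double\<close> every factor is 0 or 1, so the product is an
  indicator.\<close>

lemma spectrum_term_2:
  assumes "s \<subseteq> {..<2 * Suc (dim_vec v)}"
  shows "spectrum_term v s 2 = of_bool (s = full_word v)"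
proof (cases "s = full_word v")
  case True
  then show ?thesis
    using full_word_iff[of _ v]
    by (auto simp: spectrum_term_def gray_coeff_double simp del: prod.lessThan_Suc intro!: prod.neutral)
next
  case False
  then obtain j where "j < Suc (dim_vec v)"
    "\<not> ((2 * j \<in> s \<longleftrightarrow> odd4 (check_vec v j)) \<and> (Suc (2 * j) \<in> s \<longleftrightarrow> odd4 (check_vec v j)))"
    using column_set_eqI[OF assms full_word_subset] full_word_iff by metis
  then have "spectrum_term v s 2 = 0"
    unfolding spectrum_term_def gray_coeff_double by (intro prod_zero) auto
  with False show ?thesis by simp
qed

lemma spectrum_term_3: "spectrum_term v s 3 = cnj (spectrum_term v s 1)"
proof -
  have "3 * x = - (1 * x)" for x :: 4
    using exhaust_4[of x] by (auto simp: numerals_4)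
  then show ?thesis by (simp only: spectrum_term_def gray_coeff_uminus cnj_prod)
qed

lemma sum_spectrum:
  assumes "s \<noteq> {}" "s \<subseteq> {..<2 * Suc (dim_vec v)}"
  shows "(\<Sum>k\<in>UNIV. spectrum_term v s k) =
    of_real (of_bool (s = full_word v) + 2 * Re (spectrum_term v s 1))"
  using assms
  by (simp add: sum_UNIV_4 spectrum_term_0 spectrum_term_2 spectrum_term_3 complex_eq_iff)

lemma gray_coeff_nonzero_iff:
  "gray_coeff a b x \<noteq> 0 \<longleftrightarrow> (if a = b then x = (if a then 2 else 0) else odd4 x)"
  by (auto simp: gray_coeff_def odd4_def complex_eq_iff)

lemma spectrum_term_1_partial_word:
  assumes "Q \<subseteq> odd_positions v"
  shows "spectrum_term v (partial_word v Q) 1 =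
    ((1 + \<i>) / 2) ^ card Q * ((1 - \<i>) / 2) ^ card (odd_positions v - Q)"
proof -
  let ?J = "odd_positions v"
  have "spectrum_term v (partial_word v Q) 1 =
      (\<Prod>j<Suc (dim_vec v). if j \<in> ?J then if j \<in> Q then (1 + \<i>) / 2 else (1 - \<i>) / 2 else 1)"
    unfolding spectrum_term_def
  proof (intro prod.cong refl)
    \<comment> \<open>The factor is 1 at check entries 0 and 2, where \<open>partial_word\<close>
      takes no column and both columns.\<close>
    fix j assume "j \<in> {..<Suc (dim_vec v)}"
    then show "gray_coeff (2 * j \<in> partial_word v Q) (Suc (2 * j) \<in> partial_word v Q) (1 * check_vec v j) =
      (if j \<in> ?J then if j \<in> Q then (1 + \<i>) / 2 else (1 - \<i>) / 2 else 1)"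
      using exhaust_4[of "check_vec v j"] partial_word_iff[of j v Q]
      by (cases "j \<in> Q"; elim disjE) (auto simp: odd_positions_def odd4_simps gray_coeff_simps)
  qed
  also have "\<dots> = (\<Prod>j\<in>?J. if j \<in> Q then (1 + \<i>) / 2 else (1 - \<i>) / 2)"
    by (subst prod.inter_restrict[symmetric])
      (auto simp: odd_positions_def intro!: prod.cong)
  also have "\<dots> = ((1 + \<i>) / 2) ^ card Q * ((1 - \<i>) / 2) ^ card (?J - Q)"
    using assms by (simp add: prod.If_cases finite_odd_positions Int_absorb1 Diff_eq)
  finally show ?thesis .
qed

lemma spectrum_term_1_nonzero:
  assumes "s \<subseteq> {..<2 * Suc (dim_vec v)}" "spectrum_term v s 1 \<noteq> 0"
  shows "s \<in> partial_word v ` Pow (odd_positions v)"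
proof
  \<comment> \<open>The second Gray column has coefficient \<open>(1 + \<i>) / 2\<close> at check
    entry 1 but \<open>(1 - \<i>) / 2\<close> at 3, and the first column the reverse.\<close>
  let ?Q = "{j \<in> odd_positions v. Suc (2 * j) \<in> s \<longleftrightarrow> check_vec v j = 1}"
  show "?Q \<in> Pow (odd_positions v)" by auto
  show "s = partial_word v ?Q"
  proof (rule column_set_eqI[OF assms(1) partial_word_subset])
    fix j assume j: "j < Suc (dim_vec v)"
    then have "gray_coeff (2 * j \<in> s) (Suc (2 * j) \<in> s) (check_vec v j) \<noteq> 0"
      using assms(2) by (auto simp: spectrum_term_def simp del: prod.lessThan_Suc)
    then show "(2 * j \<in> s \<longleftrightarrow> 2 * j \<in> partial_word v ?Q) \<and>
        (Suc (2 * j) \<in> s \<longleftrightarrow> Suc (2 * j) \<in> partial_word v ?Q)"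
      unfolding gray_coeff_nonzero_iff partial_word_iff[OF j] using j
      by (auto simp: odd_positions_def odd4_simps split: if_splits)
  qed
qed

section \<open>Real parts of Gaussian products and the count of subsets\<close>

lemma i_power_cases:
  "(if even p then \<i> ^ p = 1 \<or> \<i> ^ p = -1 else \<i> ^ p = \<i> \<or> \<i> ^ p = -\<i>)"
  by (induction p) auto

text \<open>Since \<open>1 - \<i> = (1 + \<i>) * \<i> ^ 3\<close> and
  \<open>(1 + \<i>)\<^sup>2 = 2 * \<i>\<close>, \<open>x\<close> is a positive real times a power of
  \<open>\<i>\<close>, with one more factor \<open>1 + \<i>\<close> iff \<open>a + b\<close> is odd.
  With that factor the real part never vanishes; without it, the power of \<open>\<i>\<close> must
  be real.\<close>

lemma Re_half_gaussian_power:
  fixes a b :: nat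
  defines "x \<equiv> ((1 + \<i>) / 2) ^ a * ((1 - \<i>) / 2) ^ b"
  shows "Re x \<noteq> 0 \<longleftrightarrow> odd (a + b) \<or> even ((a + b) div 2 + b)"
    and "Re x \<noteq> 0 \<Longrightarrow> \<bar>2 * Re x\<bar> = 2 * 2 ^ ((a + b) div 2) / 2 ^ (a + b)"
proof -
  define M t where "M = a + b" and "t = M div 2"
  have M: "M = 2 * t + M mod 2" by (simp add: t_def)
  have minus: "1 - \<i> = (1 + \<i>) * \<i> ^ 3" by (simp add: power3_eq_cube algebra_simps)
  have sq: "(1 + \<i>)\<^sup>2 = 2 * \<i>" by (simp add: power2_eq_square algebra_simps)
  have "x = (1 + \<i>) ^ M * \<i> ^ (3 * b) / 2 ^ M"
    unfolding x_def minus M_def by (simp add: power_divide power_mult_distrib power_add power_mult)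
  also have "(1 + \<i>) ^ M = 2 ^ t * \<i> ^ t * (1 + \<i>) ^ (M mod 2)"
    by (subst M) (simp only: power_add power_mult sq power_mult_distrib)
  finally have x: "x = of_real (2 ^ t / 2 ^ M) * (\<i> ^ (t + 3 * b) * (1 + \<i>) ^ (M mod 2))"
    by (simp add: power_add)
  have Re_x: "Re x = 2 ^ t / 2 ^ M * Re (\<i> ^ (t + 3 * b) * (1 + \<i>) ^ (M mod 2))"
    unfolding x by (simp only: times_complex.sel Re_complex_of_real Im_complex_of_real)
  define u where "u = \<i> ^ (t + 3 * b)"
  \<comment> \<open>The exponent \<open>t + 3 * b\<close> has the parity of
    \<open>t + b\<close>.\<close>
  have u: "u \<in> (if even (t + b) then {1, -1} else {\<i>, -\<i>})"
    using i_power_cases[of "t + 3 * b"] by (auto simp: u_def)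
  have "Re (u * (1 + \<i>) ^ (M mod 2)) \<in> (if odd M \<or> even (t + b) then {1, -1} else {0})"
  proof (cases "even M")
    case True
    then have "M mod 2 = 0" by simp
    with True u show ?thesis by (cases "even (t + b)") auto
  next
    case False
    then have "M mod 2 = 1" by presburger
    with False u show ?thesis by (cases "even (t + b)") auto
  qed
  then show "Re x \<noteq> 0 \<longleftrightarrow> odd (a + b) \<or> even ((a + b) div 2 + b)"
    and "Re x \<noteq> 0 \<Longrightarrow> \<bar>2 * Re x\<bar> = 2 * 2 ^ ((a + b) div 2) / 2 ^ (a + b)"
    unfolding Re_x M_def[symmetric] t_def[symmetric] u_def[symmetric] by (auto split: if_splits)
qed

text \<open>A nonempty finite set has as many even as odd subsets, and together they exhaust
  \<open>Pow J\<close>.\<close>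

lemma card_subsets_parity:
  assumes "finite J" "J \<noteq> {}"
  shows "2 * card {Q \<in> Pow J. even (card Q) = p} = 2 ^ card J"
proof -
  let ?E = "{Q. Q \<subseteq> J \<and> even (card Q)}" and ?O = "{Q. Q \<subseteq> J \<and> odd (card Q)}"
  have fin: "finite ?E" "finite ?O" using assms(1) by simp_all
  have "card ?E = card ?O"
    using card_subsupersets_even_odd[OF assms(1), of "{}"] assms(2) by auto
  moreover have "card ?E + card ?O = card (Pow J)"
    using fin by (subst card_Un_disjoint[symmetric]) (auto intro: arg_cong[where f = card])
  ultimately show ?thesis using assms(1) by (cases p) (simp_all add: card_Pow)
qed

text \<open>For even \<open>m\<close> every subset counts, giving \<open>2 ^ (m + 1)\<close>; for
  odd \<open>m\<close> the parity of \<open>Q\<close> is prescribed, leaving half of them,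
  \<open>2 ^ m\<close>. Both equal \<open>2 * 4 ^ (m div 2)\<close>.\<close>

lemma card_subsets_half_gaussian:
  assumes "finite J" "card J = Suc m"
  shows "card {Q \<in> Pow J. odd (card J) \<or> even (card J div 2 + card (J - Q))} = 2 * 4 ^ (m div 2)"
proof (cases "even m")
  case True
  then have "{Q \<in> Pow J. odd (card J) \<or> even (card J div 2 + card (J - Q))} = Pow J"
    using assms by auto
  with True assms show ?thesis by (auto simp: card_Pow power_mult elim!: evenE)
next
  case False
  then have ev: "even (card J)" using assms by simp
  have "even (card (J - Q)) = even (card Q)" if "Q \<subseteq> J" for Q
    using that assms(1) ev card_mono[OF assms(1) that]
    by (simp add: card_Diff_subset finite_subset)
  then have "{Q \<in> Pow J. odd (card J) \<or> even (card J div 2 + card (J - Q))} =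
      {Q \<in> Pow J. even (card Q) = even (card J div 2)}"
    using ev by auto
  moreover have "J \<noteq> {}" using assms by auto
  ultimately show ?thesis
    using card_subsets_parity[OF assms(1), of "even (card J div 2)"] False assms(2)
    by (auto simp: power_mult elim!: oddE)
qed

section \<open>Positions of the dual vector in terms of the entry counts of \<open>v\<close>\<close>

lemma card_check_vec:
  "card {j. j < Suc (dim_vec v) \<and> P (check_vec v j)} =
    of_bool (P 1) + card {r. r < dim_vec v \<and> P (- v $ r)}"
proof -
  have "{j. j < Suc (dim_vec v) \<and> P (check_vec v j)} =
      (if P 1 then {0} else {}) \<union> Suc ` {r. r < dim_vec v \<and> P (- v $ r)}"
    by (auto simp: check_vec_def less_Suc_eq_0_disj image_iff)
  then show ?thesis by (auto simp: card_image card_insert_if)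
qed

lemma uminus_4_eq: "- x = 2 \<longleftrightarrow> x = 2" "odd4 (- x) \<longleftrightarrow> x = 1 \<or> x = 3" for x :: 4
  using exhaust_4[of x] by (auto simp: numerals_4 odd4_def)

lemma card_check_vec_2:
  "card {j. j < Suc (dim_vec v) \<and> check_vec v j = 2} = entry_count v 2"
  using card_check_vec[of v "\<lambda>x. x = 2"] by (simp add: uminus_4_eq entry_count_def)

text \<open>The successor accounts for the leading 1 of (1, -v); negation swaps 1 and 3 and so
  preserves oddness.\<close>

lemma card_odd_positions: "card (odd_positions v) = Suc (entry_count v 1 + entry_count v 3)"
proof -
  let ?A = "\<lambda>a. {r. r < dim_vec v \<and> v $ r = a}"
  have "{r. r < dim_vec v \<and> odd4 (- v $ r)} = ?A 1 \<union> ?A 3"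
    by (auto simp: uminus_4_eq)
  moreover have "?A 1 \<inter> ?A 3 = {}" by auto
  ultimately have "card {r. r < dim_vec v \<and> odd4 (- v $ r)} = card (?A 1) + card (?A 3)"
    by (simp only:) (rule card_Un_disjoint; simp)
  then show ?thesis
    using card_check_vec[of v odd4] by (simp add: odd_positions_def entry_count_def odd4_simps)
qed

section \<open>Enumeration of the words with their lengths and aliasing indices\<close>

theorem theorem1:
  fixes n :: nat and v :: "4 vec" and us :: "4 vec list"
    and D :: "int mat" and f\<^sub>1 f\<^sub>2 f\<^sub>3 k\<^sub>1 k\<^sub>2 :: nat and \<rho> :: real
  assumes "n \<ge> 1" and "v \<in> carrier_vec n"
    and "lists_all_vecs n us"
    and "D = design us (generator_matrix n v)"
    and "f\<^sub>1 = entry_count v 1" and "f\<^sub>2 = entry_count v 2" and "f\<^sub>3 = entry_count v 3"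
    and "k\<^sub>1 = f\<^sub>1 + 2 * f\<^sub>2 + f\<^sub>3 + 1"
    and "k\<^sub>2 = 2 * f\<^sub>1 + 2 * f\<^sub>3 + 2"
    and "\<rho> = 2 powi (- \<lfloor>real (f\<^sub>1 + f\<^sub>3) / 2\<rfloor>)"
  shows "D \<in> carrier_mat (2 ^ (2 * n)) (2 * n + 2) \<and>
    (\<exists>w P. words D = insert w P \<and> w \<notin> P \<and>
       card w = k\<^sub>2 \<and> aliasing_index D w = 1 \<and>
       real (card P) = 2 / \<rho>\<^sup>2 \<and>
       (\<forall>s\<in>P. card s = k\<^sub>1 \<and> aliasing_index D s = \<rho>))"
proof (intro conjI)
  show D: "D \<in> carrier_mat (2 ^ (2 * n)) (2 * n + 2)"
    using assms(3,4) design_carrier by simp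
  define m where "m = f\<^sub>1 + f\<^sub>3"
  let ?J = "odd_positions v" and ?w = "full_word v"
  \<comment> \<open>When \<open>card ?J\<close> is even, the two conjugate terms cancel for half of
    the sets \<open>Q\<close>; those must be left out.\<close>
  let ?P = "{s \<in> partial_word v ` Pow ?J. Re (spectrum_term v s 1) \<noteq> 0}"
  have dim: "dim_vec v = n" using assms(2) by auto
  have J: "finite ?J" "card ?J = Suc m"
    using assms(5,7) by (simp_all add: finite_odd_positions card_odd_positions m_def)
  have \<rho>: "\<rho> = 1 / 2 ^ (m div 2)"
    using assms(10) floor_divide_of_nat_eq[of m 2, where ?'a = real]
    unfolding m_def[symmetric] by (simp add: power_int_minus inverse_eq_divide)
  \<comment> \<open>The factor \<open>4 ^ n\<close> in \<open>j_char_design\<close> is the number of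
    runs and cancels.\<close>
  have alias_eq: "aliasing_index D s = \<bar>of_bool (s = ?w) + 2 * Re (spectrum_term v s 1)\<bar>"
    if "s \<noteq> {}" "s \<subseteq> {..<2 * Suc n}" for s
  proof -
    let ?x = "of_bool (s = ?w) + 2 * Re (spectrum_term v s 1)"
    have "complex_of_int (j_char D s) = complex_of_real (4 ^ n * ?x)"
      using j_char_design[OF assms(2,3) that(2)] sum_spectrum[of s v] that dim assms(4) by simp
    then have "real_of_int (j_char D s) = 4 ^ n * ?x"
      by (metis of_real_eq_iff of_real_of_int_eq)
    moreover have "real (dim_row D) = 4 ^ n" using D by (simp add: power_mult)
    ultimately show ?thesis by (simp add: aliasing_index_def abs_mult)
  qed
  have zero: "0 \<in> ?J" by (simp add: odd_positions_def check_vec_def odd4_simps)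
  have w: "?w \<noteq> {}" using card_full_word[of v] J by auto
  \<comment> \<open>Position 0 has check entry 1, but \<open>?w\<close> takes both its columns, so
    this factor vanishes. This keeps \<open>?w\<close> out of \<open>?P\<close> even when
    \<open>\<rho>\<close> is 1.\<close>
  have w1: "spectrum_term v ?w 1 = 0"
    unfolding spectrum_term_def
    using full_word_iff[of 0 v] by (intro prod_zero bexI[of _ 0])
      (auto simp: check_vec_def odd4_simps gray_coeff_simps)
  have notw: "?w \<notin> ?P" by (simp add: w1)
  have card_P: "card s = k\<^sub>1" if "s \<in> ?P" for s
    using that assms(5-8) by (auto simp: card_partial_word card_check_vec_2 card_odd_positions)
  have nonempty: "s \<noteq> {}" if "s \<in> ?P" for s using card_P[OF that] assms(8) by auto
  have sub: "s \<subseteq> {..<2 * Suc n}" if "s \<in> ?P" for s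
    using that partial_word_subset[of v] dim by auto
  have alias_P: "aliasing_index D s = \<bar>2 * Re (spectrum_term v s 1)\<bar>" if "s \<in> ?P" for s
    using alias_eq[OF nonempty[OF that] sub[OF that]] that notw by auto
  have alias_w: "aliasing_index D ?w = 1"
    using alias_eq[OF w] full_word_subset[of v] dim w1 by simp
  have card_Q: "card Q + card (?J - Q) = card ?J" if "Q \<subseteq> ?J" for Q
    using that J(1) card_mono[OF J(1) that] by (simp add: card_Diff_subset finite_subset)
  have Re_iff: "Re (spectrum_term v (partial_word v Q) 1) \<noteq> 0 \<longleftrightarrow>
      odd (card ?J) \<or> even (card ?J div 2 + card (?J - Q))" if "Q \<subseteq> ?J" for Q
    using Re_half_gaussian_power(1)[of "card Q" "card (?J - Q)"] card_Q[OF that]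
    by (simp only: spectrum_term_1_partial_word[OF that])
  have "words D = insert ?w ?P"
  proof (intro equalityI subsetI)
    fix s assume "s \<in> words D"
    then have s: "s \<noteq> {}" "s \<subseteq> {..<2 * Suc n}" "aliasing_index D s > 0"
      using D by (auto simp: words_def)
    then have "s \<noteq> ?w \<Longrightarrow> Re (spectrum_term v s 1) \<noteq> 0" using alias_eq[OF s(1,2)] by auto
    then show "s \<in> insert ?w ?P"
      using spectrum_term_1_nonzero[of s v] s(2) dim by fastforce
  next
    fix s assume "s \<in> insert ?w ?P"
    then show "s \<in> words D"
    proof
      assume "s = ?w"
      then show ?thesis using w alias_w full_word_subset[of v] dim D by (simp add: words_def)
    next
      assume "s \<in> ?P"
      then show ?thesis using nonempty sub alias_P[of s] D by (simp add: words_def)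
    qed
  qed
  moreover have "card ?w = k\<^sub>2" using J assms(9) by (simp add: card_full_word m_def)
  moreover have "real (card ?P) = 2 / \<rho>\<^sup>2"
  proof -
    have "?P = partial_word v ` {Q \<in> Pow ?J. odd (card ?J) \<or> even (card ?J div 2 + card (?J - Q))}"
      using Re_iff by blast
    then have "card ?P = card {Q \<in> Pow ?J. odd (card ?J) \<or> even (card ?J div 2 + card (?J - Q))}"
      by (simp only:) (rule card_image, rule inj_on_subset[OF partial_word_inj], blast)
    then have "card ?P = 2 * 4 ^ (m div 2)"
      by (simp only: card_subsets_half_gaussian[OF J])
    moreover have "(2 ^ k)\<^sup>2 = (4 :: real) ^ k" for k
      by (simp add: power2_eq_square flip: power_mult_distrib)
    ultimately show ?thesis unfolding \<rho> by (simp add: power_divide)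
  qed
  moreover have "aliasing_index D s = \<rho>" if s: "s \<in> ?P" for s
  proof -
    obtain Q where Q: "Q \<subseteq> ?J" "s = partial_word v Q" using s by auto
    have x: "spectrum_term v s 1 = ((1 + \<i>) / 2) ^ card Q * ((1 - \<i>) / 2) ^ card (?J - Q)"
      using Q spectrum_term_1_partial_word by simp
    have "Re (spectrum_term v s 1) \<noteq> 0" using s by blast
    then have "aliasing_index D s = 2 * 2 ^ (card ?J div 2) / 2 ^ card ?J"
      unfolding alias_P[OF s] x card_Q[OF Q(1), symmetric] by (rule Re_half_gaussian_power(2))
    \<comment> \<open>This rests on \<open>Suc m div 2 + m div 2 = m\<close>.\<close>
    also have "\<dots> = \<rho>"
      unfolding \<rho> J(2) by (cases "even m") (auto elim!: evenE oddE simp: mult_2_right power_add field_simps)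
    finally show ?thesis .
  qed
  ultimately show "\<exists>w P. words D = insert w P \<and> w \<notin> P \<and>
       card w = k\<^sub>2 \<and> aliasing_index D w = 1 \<and>
       real (card P) = 2 / \<rho>\<^sup>2 \<and>
       (\<forall>s\<in>P. card s = k\<^sub>1 \<and> aliasing_index D s = \<rho>)"
    using notw alias_w card_P by (intro exI[of _ ?w] exI[of _ ?P] conjI ballI)
qed

end
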